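(* Let $X$ be an involutive BE algebra. Then $X$ is an implicative-orthomodular algebra if and only if it satisfies the following equivalent conditions (each understood for all $x,y\in X$): (IOM) $x\Cap (x^*\to y)=x$; (IOM$'$) $x\Cap (y\to x)=x$; (IOM$''$) $x\Cup (x\to y)^*=x$.
   Context: A BE algebra is an algebra $(X,\to,1)$ of type $(2,0)$ such that for all $x,y,z\in X$: $x\to x=1$; $x\to 1=1$; $1\to x=x$; $x\to (y\to z)=y\to (x\to z)$. Write $x\le y$ iff $x\to y=1$. It is bounded if there is $0\in X$ with $0\le x$ for all $x\in X$; then $x^*:=x\to 0$. It is involutive if it is bounded and $x^{**}=x$ for all $x\in X$; an involutive BE algebra is denoted $(X,\to,^*,1)$. In an involutive BE algebra define $x\Cup y=(x\to y)\to y$ and $x\Cap y=((x^*\to y^* )\to y^* )^*$. An implicative-orthomodular algebra is an involutive BE algebra satisfying $x\to (y\Cap (z\Cap x))=(x\to y)\Cap (x\to z)$ for all $x,y,z\in X$. *)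

theory Defs
  imports "HOL-Algebra.Congruence"
begin

record 'a be = "'a partial_object" +
  imp :: "'a \<Rightarrow> 'a \<Rightarrow> 'a"  (infixr "\<leadsto>\<index>" 60)
  one :: 'a  ("\<one>\<index>")

text \<open>The bottom element is carried as data, so that the complement below refers to the chosen
  element; in an involutive BE algebra it is uniquely determined.\<close>

record 'a bounded_be = "'a be" +
  zero :: 'a  ("\<zero>\<index>")

definition be_le :: "('a, 'm) be_scheme \<Rightarrow> 'a \<Rightarrow> 'a \<Rightarrow> bool"  (infix "\<preceq>\<index>" 50) where
  "x \<preceq>\<^bsub>X\<^esub> y \<longleftrightarrow> x \<leadsto>\<^bsub>X\<^esub> y = \<one>\<^bsub>X\<^esub>"

definition be_star :: "('a, 'm) bounded_be_scheme \<Rightarrow> 'a \<Rightarrow> 'a"  ("_\<^sup>\<star>\<index>" [1000] 999) where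
  "x\<^sup>\<star>\<^bsub>X\<^esub> = x \<leadsto>\<^bsub>X\<^esub> \<zero>\<^bsub>X\<^esub>"

definition be_cup :: "('a, 'm) be_scheme \<Rightarrow> 'a \<Rightarrow> 'a \<Rightarrow> 'a"  (infixl "\<Cup>\<index>" 65) where
  "x \<Cup>\<^bsub>X\<^esub> y = (x \<leadsto>\<^bsub>X\<^esub> y) \<leadsto>\<^bsub>X\<^esub> y"

definition be_cap :: "('a, 'm) bounded_be_scheme \<Rightarrow> 'a \<Rightarrow> 'a \<Rightarrow> 'a"  (infixl "\<Cap>\<index>" 70) where
  "x \<Cap>\<^bsub>X\<^esub> y = ((x\<^sup>\<star>\<^bsub>X\<^esub> \<leadsto>\<^bsub>X\<^esub> y\<^sup>\<star>\<^bsub>X\<^esub>) \<leadsto>\<^bsub>X\<^esub> y\<^sup>\<star>\<^bsub>X\<^esub>)\<^sup>\<star>\<^bsub>X\<^esub>"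

locale be_algebra =
  fixes X :: "('a, 'm) be_scheme" (structure)
  assumes imp_closed: "\<lbrakk>x \<in> carrier X; y \<in> carrier X\<rbrakk> \<Longrightarrow> x \<leadsto> y \<in> carrier X"
    and one_closed: "\<one> \<in> carrier X"
    and imp_refl: "x \<in> carrier X \<Longrightarrow> x \<leadsto> x = \<one>"
    and imp_one: "x \<in> carrier X \<Longrightarrow> x \<leadsto> \<one> = \<one>"
    and one_imp: "x \<in> carrier X \<Longrightarrow> \<one> \<leadsto> x = x"
    and imp_exchange: "\<lbrakk>x \<in> carrier X; y \<in> carrier X; z \<in> carrier X\<rbrakk> \<Longrightarrow>
      x \<leadsto> (y \<leadsto> z) = y \<leadsto> (x \<leadsto> z)"

locale bounded_be_algebra = be_algebra X
  for X :: "('a, 'm) bounded_be_scheme" (structure) +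
  assumes zero_closed: "\<zero> \<in> carrier X"
    and zero_le: "x \<in> carrier X \<Longrightarrow> \<zero> \<preceq> x"

locale involutive_be_algebra = bounded_be_algebra +
  assumes star_star: "x \<in> carrier X \<Longrightarrow> (x\<^sup>\<star>)\<^sup>\<star> = x"

locale implicative_orthomodular_algebra = involutive_be_algebra +
  assumes imp_cap: "\<lbrakk>x \<in> carrier X; y \<in> carrier X; z \<in> carrier X\<rbrakk> \<Longrightarrow>
    x \<leadsto> (y \<Cap> (z \<Cap> x)) = (x \<leadsto> y) \<Cap> (x \<leadsto> z)"

end

theory Submission
  imports Defs
begin

text \<open>An involutive BE algebra is a commutative monoid under \<open>x \<oplus> y = x\<^sup>\<star> \<leadsto> y\<close>, with a De Morgan dual
  \<open>\<odot>\<close>, and \<open>x \<Cap> y = (x \<oplus> y\<^sup>\<star>) \<odot> y\<close>. Putting \<open>y = \<zero>\<close> in the defining identity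
  gives (IOM) for \<open>x\<^sup>\<star>\<close>. Conversely, with \<open>s = x\<^sup>\<star> \<oplus> z\<close> and \<open>t = y \<oplus> s\<^sup>\<star> \<oplus> x\<^sup>\<star>\<close>, the
  identity says \<open>x \<leadsto> (t \<odot> s) \<odot> x = t \<odot> s\<close>, that is, \<open>a \<Cap> x = a\<close> for \<open>a = (t \<odot> s)\<^sup>\<star>\<close>; applying the dual
  of (IOM) twice writes \<open>x\<close> as \<open>a \<oplus> q\<close>, and (IOM) concludes.\<close>

context involutive_be_algebra
begin

definition oplus :: "'a \<Rightarrow> 'a \<Rightarrow> 'a"  (infixl "\<oplus>" 65) where
  "x \<oplus> y = x\<^sup>\<star> \<leadsto> y"

definition odot :: "'a \<Rightarrow> 'a \<Rightarrow> 'a"  (infixl "\<odot>" 70) where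
  "x \<odot> y = (x\<^sup>\<star> \<oplus> y\<^sup>\<star>)\<^sup>\<star>"

lemma star_closed [simp]: "x \<in> carrier X \<Longrightarrow> x\<^sup>\<star> \<in> carrier X"
  by (simp add: be_star_def imp_closed zero_closed)

lemma oplus_closed [simp]: "x \<in> carrier X \<Longrightarrow> y \<in> carrier X \<Longrightarrow> x \<oplus> y \<in> carrier X"
  by (simp add: oplus_def imp_closed)

lemma odot_closed [simp]: "x \<in> carrier X \<Longrightarrow> y \<in> carrier X \<Longrightarrow> x \<odot> y \<in> carrier X"
  by (simp add: odot_def)

lemma imp_eq_oplus: "x \<in> carrier X \<Longrightarrow> x \<leadsto> y = x\<^sup>\<star> \<oplus> y"
  by (simp add: oplus_def star_star)

text \<open>Contraposition: unfolding the complements as implications into \<open>\<zero>\<close>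
  leaves an instance of the exchange law.\<close>

lemma imp_star_commute:
  "x \<in> carrier X \<Longrightarrow> y \<in> carrier X \<Longrightarrow> x \<leadsto> y\<^sup>\<star> = y \<leadsto> x\<^sup>\<star>"
  unfolding be_star_def by (rule imp_exchange) (simp_all add: zero_closed)

lemma oplus_commute:
  "x \<in> carrier X \<Longrightarrow> y \<in> carrier X \<Longrightarrow> x \<oplus> y = y \<oplus> x"
  using imp_star_commute[of "x\<^sup>\<star>" "y\<^sup>\<star>"] by (simp add: oplus_def star_star)

text \<open>This is the exchange law applied to \<open>x\<^sup>\<star>\<close> and
  \<open>y\<^sup>\<star>\<close>; with commutativity it yields associativity.\<close>

lemma oplus_left_commute:
  "\<lbrakk>x \<in> carrier X; y \<in> carrier X; z \<in> carrier X\<rbrakk> \<Longrightarrow> x \<oplus> (y \<oplus> z) = y \<oplus> (x \<oplus> z)"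
  by (simp add: oplus_def imp_exchange)

lemma oplus_assoc:
  assumes "x \<in> carrier X" "y \<in> carrier X" "z \<in> carrier X"
  shows "x \<oplus> y \<oplus> z = x \<oplus> (y \<oplus> z)"
  using assms by (metis oplus_commute oplus_left_commute oplus_closed)

lemma star_oplus: "x \<in> carrier X \<Longrightarrow> y \<in> carrier X \<Longrightarrow> (x \<oplus> y)\<^sup>\<star> = x\<^sup>\<star> \<odot> y\<^sup>\<star>"
  by (simp add: odot_def star_star)

lemma star_odot: "x \<in> carrier X \<Longrightarrow> y \<in> carrier X \<Longrightarrow> (x \<odot> y)\<^sup>\<star> = x\<^sup>\<star> \<oplus> y\<^sup>\<star>"
  by (simp add: odot_def star_star)

lemma odot_commute: "x \<in> carrier X \<Longrightarrow> y \<in> carrier X \<Longrightarrow> x \<odot> y = y \<odot> x"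
  by (simp add: odot_def oplus_commute)

lemma odot_assoc:
  "\<lbrakk>x \<in> carrier X; y \<in> carrier X; z \<in> carrier X\<rbrakk> \<Longrightarrow> x \<odot> y \<odot> z = x \<odot> (y \<odot> z)"
  by (simp add: odot_def star_star oplus_assoc)

lemma odot_left_commute:
  "\<lbrakk>x \<in> carrier X; y \<in> carrier X; z \<in> carrier X\<rbrakk> \<Longrightarrow> x \<odot> (y \<odot> z) = y \<odot> (x \<odot> z)"
  by (simp add: odot_def star_star oplus_left_commute)

lemma cap_eq: "x \<in> carrier X \<Longrightarrow> y \<in> carrier X \<Longrightarrow> x \<Cap> y = (x \<oplus> y\<^sup>\<star>) \<odot> y"
  by (simp add: be_cap_def odot_def oplus_def imp_closed star_star)

lemma star_cap: "x \<in> carrier X \<Longrightarrow> y \<in> carrier X \<Longrightarrow> (x \<Cap> y)\<^sup>\<star> = x\<^sup>\<star> \<Cup> y\<^sup>\<star>"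
  by (simp add: be_cap_def be_cup_def imp_closed star_star)

text \<open>Since \<open>\<zero>\<^sup>\<star> = \<one>\<close>, the formula collapses to
  \<open>(x\<^sup>\<star> \<leadsto> x\<^sup>\<star>)\<^sup>\<star> = \<one>\<^sup>\<star> =
  \<zero>\<close>.\<close>

lemma zero_cap: "x \<in> carrier X \<Longrightarrow> \<zero> \<Cap> x = \<zero>"
proof -
  assume x: "x \<in> carrier X"
  have "\<zero>\<^sup>\<star> = \<one>"
    by (simp add: be_star_def imp_refl zero_closed)
  then show ?thesis
    using x star_star[OF zero_closed]
    by (simp add: be_cap_def one_imp imp_refl)
qed

lemma iom_of_orthomodular:
  assumes ax: "\<And>x y z. \<lbrakk>x \<in> carrier X; y \<in> carrier X; z \<in> carrier X\<rbrakk> \<Longrightarrow>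
      x \<leadsto> (y \<Cap> (z \<Cap> x)) = (x \<leadsto> y) \<Cap> (x \<leadsto> z)"
    and "x \<in> carrier X" "y \<in> carrier X"
  shows "x \<Cap> (x \<oplus> y) = x"
proof -
  \<comment> \<open>The right side is already the goal's left side, and the left side collapses to
    \<open>x\<^sup>\<star> \<leadsto> \<zero> = x\<close> because \<open>\<zero>\<close> absorbs the
    inner term.\<close>
  have "x\<^sup>\<star> \<leadsto> (\<zero> \<Cap> (y \<Cap> x\<^sup>\<star>)) = (x\<^sup>\<star> \<leadsto> \<zero>) \<Cap> (x\<^sup>\<star> \<leadsto> y)"
    using assms zero_closed by simp
  moreover have "\<zero> \<Cap> (y \<Cap> x\<^sup>\<star>) = \<zero>"
    using assms by (intro zero_cap) (simp add: cap_eq)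
  moreover have "x\<^sup>\<star> \<leadsto> \<zero> = x"
    using star_star[OF assms(2)] by (simp add: be_star_def)
  ultimately show ?thesis
    by (simp add: oplus_def)
qed

lemma orthomodular_of_iom:
  assumes iom: "\<And>x y. x \<in> carrier X \<Longrightarrow> y \<in> carrier X \<Longrightarrow> x \<Cap> (x \<oplus> y) = x"
    and [simp]: "x \<in> carrier X" "y \<in> carrier X" "z \<in> carrier X"
  shows "x \<leadsto> (y \<Cap> (z \<Cap> x)) = (x \<leadsto> y) \<Cap> (x \<leadsto> z)"
proof -
  \<comment> \<open>An orthomodular decomposition of \<open>u\<close> into
    \<open>u \<odot> v\<close>, which lies below \<open>u\<close>, and a remainder; it is (IOM) for
    the complements of \<open>u\<close> and \<open>v\<close>, complemented.\<close>
  have split: "u = u \<odot> v \<oplus> (u \<odot> v)\<^sup>\<star> \<odot> u" if [simp]: "u \<in> carrier X" "v \<in> carrier X" for u v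
  proof -
    have "u = (u\<^sup>\<star> \<Cap> (u\<^sup>\<star> \<oplus> v\<^sup>\<star>))\<^sup>\<star>"
      by (simp add: iom star_star)
    also have "\<dots> = u \<odot> (u \<odot> v)\<^sup>\<star> \<oplus> u \<odot> v"
      by (simp add: cap_eq star_oplus star_odot star_star)
    also have "\<dots> = u \<odot> v \<oplus> (u \<odot> v)\<^sup>\<star> \<odot> u"
      by (simp add: oplus_commute odot_commute)
    finally show ?thesis .
  qed
  \<comment> \<open>Here \<open>s\<close> is \<open>x \<leadsto> z\<close> and
    \<open>s \<odot> x\<close> is \<open>z \<Cap> x\<close>. Hence
    \<open>y \<Cap> (z \<Cap> x) = t \<odot> (s \<odot> x)\<close>, while the goal's right side is
    \<open>t \<odot> s\<close>.\<close>
  define s where "s = x\<^sup>\<star> \<oplus> z"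
  define t where "t = y \<oplus> (s\<^sup>\<star> \<oplus> x\<^sup>\<star>)"
  define a where "a = (t \<odot> s)\<^sup>\<star>"
  define q where "q = (s \<odot> x \<odot> y\<^sup>\<star>)\<^sup>\<star> \<odot> (s \<odot> x)"
  have [simp]: "s \<in> carrier X" "t \<in> carrier X" "a \<in> carrier X" "q \<in> carrier X"
    by (simp_all add: s_def t_def a_def q_def)
  have s_star: "s\<^sup>\<star> = x \<odot> z\<^sup>\<star>"
    by (simp add: s_def star_oplus star_star)
  have t_star: "t\<^sup>\<star> = s \<odot> x \<odot> y\<^sup>\<star>"
    by (simp add: t_def star_oplus star_star odot_commute)
  \<comment> \<open>Decomposing \<open>x\<close> along \<open>z\<^sup>\<star>\<close> splits off
    \<open>s\<^sup>\<star>\<close>; decomposing the remainder \<open>s \<odot> x\<close> along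
    \<open>y\<^sup>\<star>\<close> splits off \<open>t\<^sup>\<star>\<close> and leaves
    \<open>q\<close>. The two pieces split off add up to \<open>a\<close>.\<close>
  have "x = s\<^sup>\<star> \<oplus> s \<odot> x"
    using split[of x "z\<^sup>\<star>"] by (simp flip: s_star add: star_star)
  also have "s \<odot> x = t\<^sup>\<star> \<oplus> q"
    unfolding t_star q_def by (rule split) simp_all
  also have "s\<^sup>\<star> \<oplus> (t\<^sup>\<star> \<oplus> q) = a \<oplus> q"
    by (simp add: a_def star_odot oplus_assoc oplus_left_commute)
  finally have a_cap: "a \<Cap> x = a"
    using iom[of a q] by simp
  have "z \<Cap> x = s \<odot> x"
    by (simp add: cap_eq s_def oplus_commute)
  then have "x \<leadsto> (y \<Cap> (z \<Cap> x)) = x\<^sup>\<star> \<oplus> t \<odot> (s \<odot> x)"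
    by (simp add: imp_eq_oplus cap_eq star_odot t_def)
  \<comment> \<open>De Morgan applied to
    \<open>a \<Cap> x = (a \<oplus> x\<^sup>\<star>) \<odot> x\<close>, using
    \<open>a\<^sup>\<star> = t \<odot> s\<close>.\<close>
  also have "\<dots> = (a \<Cap> x)\<^sup>\<star>"
    by (simp add: cap_eq star_odot star_oplus star_star a_def oplus_commute odot_assoc odot_commute
      odot_left_commute)
  also have "\<dots> = t \<odot> s"
    unfolding a_cap by (simp add: a_def star_star)
  also have "\<dots> = (x\<^sup>\<star> \<oplus> y) \<Cap> s"
    by (simp add: cap_eq t_def oplus_assoc oplus_commute oplus_left_commute)
  finally show ?thesis
    by (simp add: imp_eq_oplus s_def)
qed

end

theorem theorem3p7:
  fixes X :: "('a, 'm) bounded_be_scheme" (structure)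
  assumes "involutive_be_algebra X"
  shows "(implicative_orthomodular_algebra X \<longleftrightarrow>
            (\<forall>x\<in>carrier X. \<forall>y\<in>carrier X. x \<Cap> (x\<^sup>\<star> \<leadsto> y) = x)) \<and>
         ((\<forall>x\<in>carrier X. \<forall>y\<in>carrier X. x \<Cap> (x\<^sup>\<star> \<leadsto> y) = x) \<longleftrightarrow>
            (\<forall>x\<in>carrier X. \<forall>y\<in>carrier X. x \<Cap> (y \<leadsto> x) = x)) \<and>
         ((\<forall>x\<in>carrier X. \<forall>y\<in>carrier X. x \<Cap> (y \<leadsto> x) = x) \<longleftrightarrow>
            (\<forall>x\<in>carrier X. \<forall>y\<in>carrier X. x \<Cup> (x \<leadsto> y)\<^sup>\<star> = x))"
proof -
  interpret involutive_be_algebra X by fact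
  have iom: "implicative_orthomodular_algebra X \<longleftrightarrow>
      (\<forall>x\<in>carrier X. \<forall>y\<in>carrier X. x \<Cap> (x\<^sup>\<star> \<leadsto> y) = x)"
  proof
    assume "implicative_orthomodular_algebra X"
    then interpret implicative_orthomodular_algebra X .
    show "\<forall>x\<in>carrier X. \<forall>y\<in>carrier X. x \<Cap> (x\<^sup>\<star> \<leadsto> y) = x"
      using iom_of_orthomodular[OF imp_cap] by (simp add: oplus_def)
  next
    assume iom: "\<forall>x\<in>carrier X. \<forall>y\<in>carrier X. x \<Cap> (x\<^sup>\<star> \<leadsto> y) = x"
    show "implicative_orthomodular_algebra X"
      by unfold_locales (rule orthomodular_of_iom, simp_all add: oplus_def iom)
  qed
  \<comment> \<open>The complement maps the carrier onto itself, so a quantified variable may be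
    replaced by its complement: the second variable for (IOM'), the first for (IOM'').\<close>
  have bij: "(\<forall>y\<in>carrier X. P (y\<^sup>\<star>)) \<longleftrightarrow> (\<forall>y\<in>carrier X. P y)" for P
    by (metis star_closed star_star)
  have iom': "x \<Cap> (y\<^sup>\<star> \<leadsto> x) = x \<Cap> (x\<^sup>\<star> \<leadsto> y)" if "x \<in> carrier X" "y \<in> carrier X" for x y
    using oplus_commute[OF that] by (simp add: oplus_def)
  \<comment> \<open>De Morgan turns (IOM'') at \<open>x\<close> into (IOM) at
    \<open>x\<^sup>\<star>\<close>, where \<open>x\<^sup>\<star>\<^sup>\<star> \<leadsto> y\<close>
    is \<open>x \<leadsto> y\<close>.\<close>
  have iom'': "x \<Cup> (x \<leadsto> y)\<^sup>\<star> = x \<longleftrightarrow> x\<^sup>\<star> \<Cap> (x \<leadsto> y) = x\<^sup>\<star>"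
    if "x \<in> carrier X" "y \<in> carrier X" for x y
  proof -
    have "(x\<^sup>\<star> \<Cap> (x \<leadsto> y))\<^sup>\<star> = x \<Cup> (x \<leadsto> y)\<^sup>\<star>"
      using that by (simp add: star_cap star_star imp_closed)
    moreover have "x\<^sup>\<star> \<Cap> (x \<leadsto> y) \<in> carrier X"
      using that by (simp add: cap_eq imp_closed)
    ultimately show ?thesis
      using that by (metis star_star)
  qed
  have "(\<forall>x\<in>carrier X. \<forall>y\<in>carrier X. x \<Cap> (x\<^sup>\<star> \<leadsto> y) = x) \<longleftrightarrow>
      (\<forall>x\<in>carrier X. \<forall>y\<in>carrier X. x \<Cap> (y \<leadsto> x) = x)"
  proof (rule ball_cong[OF refl])
    fix x assume "x \<in> carrier X"
    then show "(\<forall>y\<in>carrier X. x \<Cap> (x\<^sup>\<star> \<leadsto> y) = x) \<longleftrightarrow> (\<forall>y\<in>carrier X. x \<Cap> (y \<leadsto> x) = x)"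
      using bij[of "\<lambda>y. x \<Cap> (y \<leadsto> x) = x"] iom'[of x] by simp
  qed
  moreover have "(\<forall>x\<in>carrier X. \<forall>y\<in>carrier X. x \<Cap> (x\<^sup>\<star> \<leadsto> y) = x) \<longleftrightarrow>
      (\<forall>x\<in>carrier X. \<forall>y\<in>carrier X. x \<Cup> (x \<leadsto> y)\<^sup>\<star> = x)"
    using bij[of "\<lambda>x. \<forall>y\<in>carrier X. x \<Cap> (x\<^sup>\<star> \<leadsto> y) = x"] iom'' by (simp add: star_star)
  ultimately show ?thesis
    using iom by blast
qed

end
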